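(* Let $L\ge2$, let $\widehat z,\widehat w\in\widehat W_L$ be circular words and let $z=z_1\dots z_m$, $w=w_1\dots w_n$ be their representatives in $W_L$. The Poisson bracket of the generators $p(\widehat z),p(\widehat w)$ of $P_{0,L}$ has the form $$\{p(\widehat z),p(\widehat w)\}=\sum_{r=1}^m\sum_{q=1}^n\delta_{z_r,w_q}\Bigl(p(z_1\dots z_{r-1}z_rw_{q+1}\dots w_nw_1\dots w_{q-1}z_{r+1}\dots z_m)-p(z_1\dots z_{r-1}w_{q+1}\dots w_nw_1\dots w_{q-1}z_rz_{r+1}\dots z_m)\Bigr),$$ where $p(v)$ for an ordinary word $v$ denotes $p(\widehat v)$, with $\widehat v$ the circular word of $v$.
   Context: The ground field is $\mathbb C$. $E_{ij\mid\alpha}$ denotes the matrix unit $E_{ij}$ in the $\alpha$-th copy of $\mathfrak{gl}(N,\mathbb C)$ in $\mathfrak{gl}(N,\mathbb C)^{\oplus L}$, $\alpha\in[L]=\{1,\dots,L\}$; $S(\cdot)$ is the symmetric algebra; $\operatorname{diag}$ is the diagonal embedding. $P_{0,L}(N):=S(\mathfrak{gl}(N,\mathbb C)^{\oplus L})^{\operatorname{diag}\mathfrak{gl}(N,\mathbb C)}$ (adjoint invariants). Let $\mathcal I^+(N)$ be the ideal of $S(\mathfrak{gl}(N,\mathbb C)^{\oplus L})$ generated by all $E_{iN\mid\alpha}$, $1\le i\le N$, $\alpha\in[L]$, and let $P_{N-1,L}(N)$ be the subalgebra of invariants of $\operatorname{diag}E_{NN}$. Then $P_{N-1,L}(N)=S(\mathfrak{gl}(N-1,\mathbb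 C)^{\oplus L})\oplus(P_{N-1,L}(N)\cap\mathcal I^+(N))$; the projection $\pi_{N,N-1}$ onto the first summand maps $P_{0,L}(N)$ into $P_{0,L}(N-1)$. $P_{0,L}:=\varprojlim(P_{0,L}(N),\pi_{N,N-1})$ in the category of graded algebras. $P_{0,L}$ carries the Poisson bracket $\{-,-\}$ of degree $-1$ which comes, levelwise in $N$, from the canonical Poisson bracket of $S(\mathfrak{gl}(N,\mathbb C)^{\oplus L})$ (extending the Lie bracket by the Leibniz rule); the maps $\pi_{N,N-1}:P_{0,L}(N)\to P_{0,L}(N-1)$ are Poisson. Equivalently, it is induced by the commutator of the filtered algebra $A_{0,L}=\varprojlim U(\mathfrak{gl}(N,\mathbb C)^{\oplus L})^{\operatorname{diag}\mathfrak{gl}(N,\mathbb C)}$, for which $\operatorname{gr}A_{0,L}\simeq P_{0,L}$. $W_L$ is the set of nonempty words in the alphabet $[L]$, and $\widehat W_L$ is the set of circular words (classes of words under cyclic permutations of letters). For $w=w_1\dots w_n\in W_L$ with class $\widehat w$, $p(\widehat w)\in P_{0,L}$ is defined by the sequence $p(\widehat w;N)=\sum_{a_1,\dots,a_n=1}^N E_{a_1a_2\mid w_1}E_{a_2a_3\mid w_2}\cdots E_{a_na_1\mid w_n}\in P_{0,L}(N)$, which depends only on $\widehat w$ and is consistent with the $\pi_{N,N-1}$. *)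

theory Defs
  imports Complex_Main "HOL-Library.Poly_Mapping" "HOL-Library.Function_Algebras"
begin

text \<open>The index \<open>(i, j, \<alpha>)\<close> stands for the matrix unit \<open>E\<^sub>i\<^sub>j\<close> of the \<open>\<alpha>\<close>-th copy. The polynomials
  in the (infinitely many) variables of type \<open>idx\<close> contain every symmetric algebra
  \<open>S(gl(N)\<^sup>\<oplus>\<^sup>L)\<close> as the subalgebra \<open>symalg N L\<close>.\<close>

type_synonym idx = "nat \<times> nat \<times> nat"
type_synonym mon = "idx \<Rightarrow>\<^sub>0 nat"
type_synonym spoly = "mon \<Rightarrow>\<^sub>0 complex"

definition gen :: "idx \<Rightarrow> spoly" where
  "gen x = Poly_Mapping.single (Poly_Mapping.single x 1) 1"

abbreviation E :: "nat \<Rightarrow> nat \<Rightarrow> nat \<Rightarrow> spoly" where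
  "E i j \<alpha> \<equiv> gen (i, j, \<alpha>)"

abbreviation const :: "complex \<Rightarrow> spoly" where
  "const c \<equiv> Poly_Mapping.single 0 c"

definition box :: "nat \<Rightarrow> nat \<Rightarrow> idx set" where
  "box N L = {1..N} \<times> {1..N} \<times> {1..L}"

definition polys_in :: "idx set \<Rightarrow> spoly set" where
  "polys_in B = {f. \<forall>m\<in>Poly_Mapping.keys f. Poly_Mapping.keys m \<subseteq> B}"

abbreviation symalg :: "nat \<Rightarrow> nat \<Rightarrow> spoly set" where
  "symalg N L \<equiv> polys_in (box N L)"

fun lie :: "idx \<Rightarrow> idx \<Rightarrow> spoly" where
  "lie (i, j, \<alpha>) (k, l, \<beta>) =
     (if \<alpha> = \<beta> then (if j = k then E i l \<alpha> else 0) - (if l = i then E k j \<alpha> else 0) else 0)"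

text \<open>The derivation with prescribed values \<open>d x\<close> on the variables: a monomial \<open>m\<close> is sent to
  \<open>\<Sum>\<^sub>x (\<partial>m/\<partial>x) \<cdot> d x\<close>, and the map is extended linearly.\<close>

definition lin :: "(mon \<Rightarrow> spoly) \<Rightarrow> spoly \<Rightarrow> spoly" where
  "lin \<phi> f = (\<Sum>m\<in>Poly_Mapping.keys f. const (Poly_Mapping.lookup f m) * \<phi> m)"

definition der_mon :: "(idx \<Rightarrow> spoly) \<Rightarrow> mon \<Rightarrow> spoly" where
  "der_mon d m = (\<Sum>x\<in>Poly_Mapping.keys m.
     Poly_Mapping.single (m - Poly_Mapping.single x 1) (of_nat (Poly_Mapping.lookup m x)) * d x)"

definition der :: "(idx \<Rightarrow> spoly) \<Rightarrow> spoly \<Rightarrow> spoly" where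
  "der d = lin (der_mon d)"

text \<open>The canonical Poisson bracket: the Lie bracket extended by the Leibniz rule in both
  arguments. It restricts to every \<open>symalg N L\<close>; see \<open>poisson_gen\<close>, \<open>poisson_mult_left\<close>,
  \<open>poisson_mult_right\<close> and \<open>poisson_unique\<close> below. For \<open>x\<close> in the Lie algebra,
  \<open>poisson x\<close> is the adjoint action of \<open>x\<close> on the symmetric algebra.\<close>

definition poisson :: "spoly \<Rightarrow> spoly \<Rightarrow> spoly" where
  "poisson f g = der (\<lambda>x. der (\<lambda>y. lie x y) g) f"

definition diagE :: "nat \<Rightarrow> nat \<Rightarrow> nat \<Rightarrow> spoly" where
  "diagE L k l = (\<Sum>\<alpha>\<in>{1..L}. E k l \<alpha>)"

text \<open>\<open>P0N N L\<close> is \<open>P\<^sub>0\<^sub>,\<^sub>L(N)\<close> and \<open>PNN N L\<close> is \<open>P\<^sub>N\<^sub>-\<^sub>1\<^sub>,\<^sub>L(N)\<close>. As the adjoint action is linear,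
  invariance is imposed on the basis of \<open>diag gl(N)\<close>.\<close>

definition P0N :: "nat \<Rightarrow> nat \<Rightarrow> spoly set" where
  "P0N N L = {f \<in> symalg N L. \<forall>k\<in>{1..N}. \<forall>l\<in>{1..N}. poisson (diagE L k l) f = 0}"

definition PNN :: "nat \<Rightarrow> nat \<Rightarrow> spoly set" where
  "PNN N L = {f \<in> symalg N L. poisson (diagE L N N) f = 0}"

definition Iplus :: "nat \<Rightarrow> nat \<Rightarrow> spoly set" where
  "Iplus N L = {\<Sum>i\<in>{1..N}. \<Sum>\<alpha>\<in>{1..L}. s i \<alpha> * E i N \<alpha> | s. \<forall>i \<alpha>. s i \<alpha> \<in> symalg N L}"

text \<open>The projection of \<open>PNN N L = symalg (N - 1) L \<oplus> (PNN N L \<inter> Iplus N L)\<close> onto the first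
  summand; the decomposition is \<open>PNN_decomposition\<close> below.\<close>

definition proj :: "nat \<Rightarrow> nat \<Rightarrow> spoly \<Rightarrow> spoly" where
  "proj N L f = (THE g. g \<in> symalg (N - 1) L \<and> f - g \<in> PNN N L \<inter> Iplus N L)"

definition deg_le :: "nat \<Rightarrow> spoly \<Rightarrow> bool" where
  "deg_le d f \<longleftrightarrow>
     (\<forall>m\<in>Poly_Mapping.keys f. (\<Sum>x\<in>Poly_Mapping.keys m. Poly_Mapping.lookup m x) \<le> d)"

text \<open>The limit in the category of graded algebras: compatible sequences of uniformly bounded
  degree (equivalently, finite sums of compatible homogeneous sequences), with the pointwise
  algebra structure. The level \<open>N = 0\<close>, where the invariants are the constants, is included and
  does not change the limit.\<close>

definition P0 :: "nat \<Rightarrow> (nat \<Rightarrow> spoly) set" where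
  "P0 L = {F. (\<forall>N. F N \<in> P0N N L) \<and> (\<forall>N\<ge>1. proj N L (F N) = F (N - 1)) \<and>
              (\<exists>d. \<forall>N. deg_le d (F N))}"

text \<open>\<open>P0 L\<close> is closed under the levelwise bracket (\<open>poisson_lim_P0\<close>) and contains the elements
  \<open>pgen c\<close> for \<open>c \<in> cwrds L\<close> (\<open>pgen_P0\<close>).\<close>

definition poisson_lim :: "(nat \<Rightarrow> spoly) \<Rightarrow> (nat \<Rightarrow> spoly) \<Rightarrow> (nat \<Rightarrow> spoly)" where
  "poisson_lim F G = (\<lambda>N. poisson (F N) (G N))"

definition wrds :: "nat \<Rightarrow> nat list set" where
  "wrds L = {w. w \<noteq> [] \<and> set w \<subseteq> {1..L}}"

definition circ :: "nat list \<Rightarrow> nat list set" where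
  "circ w = {rotate k w | k. True}"

definition cwrds :: "nat \<Rightarrow> nat list set set" where
  "cwrds L = circ ` wrds L"

text \<open>Lists are indexed from 0; the index \<open>a\<^sub>n\<^sub>+\<^sub>1 = a\<^sub>1\<close> becomes a remainder modulo the length.\<close>

definition pword :: "nat list \<Rightarrow> nat \<Rightarrow> spoly" where
  "pword w N = (\<Sum>a | length a = length w \<and> set a \<subseteq> {1..N}.
     \<Prod>t<length w. E (a ! t) (a ! (Suc t mod length w)) (w ! t))"

text \<open>The choice of the representative is immaterial by \<open>pgen_circ\<close> below.\<close>

definition pgen :: "nat list set \<Rightarrow> (nat \<Rightarrow> spoly)" where
  "pgen c = pword (SOME v. v \<in> c)"


section \<open>The canonical Poisson bracket\<close>

lemma lin_eq:
  assumes "finite A" "Poly_Mapping.keys f \<subseteq> A"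
  shows "lin \<phi> f = (\<Sum>m\<in>A. const (Poly_Mapping.lookup f m) * \<phi> m)"
  unfolding lin_def using assms
  by (intro sum.mono_neutral_left) (auto simp: in_keys_iff)

lemma lin_add: "lin \<phi> (f + g) = lin \<phi> f + lin \<phi> g"
proof -
  let ?A = "Poly_Mapping.keys f \<union> Poly_Mapping.keys g"
  have "Poly_Mapping.keys (f + g) \<subseteq> ?A" by (rule keys_add)
  then show ?thesis
    by (simp add: lin_eq[of ?A] lookup_add single_add distrib_right sum.distrib)
qed

lemma lin_0 [simp]: "lin \<phi> 0 = 0"
  by (simp add: lin_def)

lemma lin_uminus: "lin \<phi> (- f) = - lin \<phi> f"
  using lin_add[of \<phi> f "- f"] by (simp add: eq_neg_iff_add_eq_0 add.commute)

lemma lin_diff: "lin \<phi> (f - g) = lin \<phi> f - lin \<phi> g"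
  using lin_add[of \<phi> f "- g"] by (simp add: lin_uminus)

lemma lin_sum: "lin \<phi> (\<Sum>i\<in>I. f i) = (\<Sum>i\<in>I. lin \<phi> (f i))"
  by (induction I rule: infinite_finite_induct) (auto simp: lin_add)

lemma lin_single: "lin \<phi> (Poly_Mapping.single m c) = const c * \<phi> m"
  by (cases "c = 0") (auto simp: lin_def)

lemma spoly_expand:
  "(f :: spoly) = (\<Sum>m\<in>Poly_Mapping.keys f. Poly_Mapping.single m (Poly_Mapping.lookup f m))"
proof (rule poly_mapping_eqI)
  fix k
  show "Poly_Mapping.lookup f k = Poly_Mapping.lookup
    (\<Sum>m\<in>Poly_Mapping.keys f. Poly_Mapping.single m (Poly_Mapping.lookup f m)) k"
    by (cases "k \<in> Poly_Mapping.keys f")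
       (auto simp: lookup_sum lookup_single when_def in_keys_iff)
qed

lemma mon_induct [consumes 1, case_names zero plus]:
  fixes m :: mon
  assumes B: "Poly_Mapping.keys m \<subseteq> B"
    and z: "P 0"
    and s: "\<And>x m. x \<in> B \<Longrightarrow> Poly_Mapping.keys m \<subseteq> B \<Longrightarrow> P m \<Longrightarrow> P (Poly_Mapping.single x 1 + m)"
  shows "P m"
  using B
proof (induction "\<Sum>x\<in>Poly_Mapping.keys m. Poly_Mapping.lookup m x" arbitrary: m rule: less_induct)
  case (less m)
  show ?case
  proof (cases "m = 0")
    case True then show ?thesis using z by simp
  next
    case False
    then obtain x where x: "x \<in> Poly_Mapping.keys m" using keys_eq_empty by fastforce
    define m' where "m' = m - Poly_Mapping.single x 1"
    have lx: "Poly_Mapping.lookup m x > 0" using x by (simp add: in_keys_iff)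
    have m: "m = Poly_Mapping.single x 1 + m'"
      by (rule poly_mapping_eqI) (use lx in \<open>auto simp: m'_def lookup_add lookup_minus lookup_single when_def\<close>)
    have k: "Poly_Mapping.keys m' \<subseteq> Poly_Mapping.keys m"
      by (subst m) (auto simp: in_keys_iff lookup_add)
    have "(\<Sum>x\<in>Poly_Mapping.keys m'. Poly_Mapping.lookup m' x) = (\<Sum>x\<in>Poly_Mapping.keys m. Poly_Mapping.lookup m' x)"
      using k by (intro sum.mono_neutral_left) (auto simp: in_keys_iff)
    also have "\<dots> < (\<Sum>x\<in>Poly_Mapping.keys m. Poly_Mapping.lookup m x)"
      using x lx by (intro sum_strict_mono_ex1)
        (auto simp: m'_def lookup_minus lookup_single when_def intro!: bexI[of _ x])
    finally have "P m'" using less k by auto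
    then show ?thesis using s[of x m'] x k less.prems m by auto
  qed
qed

lemma polys_const [simp, intro]: "const c \<in> polys_in B"
  by (auto simp: polys_in_def)

lemma polys_0 [simp, intro]: "0 \<in> polys_in B"
  by (auto simp: polys_in_def)

lemma polys_1 [simp, intro]: "1 \<in> polys_in B"
  by (auto simp: polys_in_def)

lemma polys_gen_iff [simp]: "gen x \<in> polys_in B \<longleftrightarrow> x \<in> B"
  by (auto simp: polys_in_def gen_def)

lemma polys_single: "Poly_Mapping.keys m \<subseteq> B \<Longrightarrow> Poly_Mapping.single m c \<in> polys_in B"
  by (auto simp: polys_in_def)

lemma polys_add [intro]: "f \<in> polys_in B \<Longrightarrow> g \<in> polys_in B \<Longrightarrow> f + g \<in> polys_in B"
  using keys_add[of f g] unfolding polys_in_def by auto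

lemma polys_uminus [intro]: "f \<in> polys_in B \<Longrightarrow> - f \<in> polys_in B"
  by (auto simp: polys_in_def in_keys_iff)

lemma polys_diff [intro]: "f \<in> polys_in B \<Longrightarrow> g \<in> polys_in B \<Longrightarrow> f - g \<in> polys_in B"
  using polys_add[of f B "- g"] by auto

lemma polys_mult [intro]: "f \<in> polys_in B \<Longrightarrow> g \<in> polys_in B \<Longrightarrow> f * g \<in> polys_in B"
proof -
  assume "f \<in> polys_in B" "g \<in> polys_in B"
  then have "Poly_Mapping.keys (a + b) \<subseteq> B" if "a \<in> Poly_Mapping.keys f" "b \<in> Poly_Mapping.keys g" for a b
    using that keys_add[of a b] unfolding polys_in_def by blast
  then show ?thesis using keys_mult[of f g] unfolding polys_in_def by blast
qed

lemma polys_sum [intro]: "(\<And>i. i \<in> I \<Longrightarrow> f i \<in> polys_in B) \<Longrightarrow> (\<Sum>i\<in>I. f i) \<in> polys_in B"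
  by (induction I rule: infinite_finite_induct) auto

lemma polys_prod [intro]: "(\<And>i. i \<in> I \<Longrightarrow> f i \<in> polys_in B) \<Longrightarrow> (\<Prod>i\<in>I. f i) \<in> polys_in B"
  by (induction I rule: infinite_finite_induct) auto

lemma polys_UNIV [simp]: "f \<in> polys_in UNIV"
  by (auto simp: polys_in_def)

lemma polys_mono: "A \<subseteq> B \<Longrightarrow> f \<in> polys_in A \<Longrightarrow> f \<in> polys_in B"
  by (auto simp: polys_in_def)

lemma polys_induct [consumes 1, case_names const gen add mult]:
  assumes f: "f \<in> polys_in B"
    and c: "\<And>c. P (const c)"
    and g: "\<And>x. x \<in> B \<Longrightarrow> P (gen x)"
    and a: "\<And>f g. f \<in> polys_in B \<Longrightarrow> g \<in> polys_in B \<Longrightarrow> P f \<Longrightarrow> P g \<Longrightarrow> P (f + g)"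
    and m: "\<And>f g. f \<in> polys_in B \<Longrightarrow> g \<in> polys_in B \<Longrightarrow> P f \<Longrightarrow> P g \<Longrightarrow> P (f * g)"
  shows "P f"
proof -
  have mon: "P (Poly_Mapping.single k 1)" if "Poly_Mapping.keys k \<subseteq> B" for k :: mon
    using that
  proof (induction k rule: mon_induct)
    case zero
    show ?case by (rule c)
  next
    case (plus x k)
    have "Poly_Mapping.single (Poly_Mapping.single x 1 + k) 1 = gen x * Poly_Mapping.single k 1"
      by (simp add: gen_def mult_single)
    moreover have "P (gen x * Poly_Mapping.single k 1)"
      by (rule m[OF _ _ g plus(3)]) (use plus in \<open>auto simp: polys_in_def gen_def\<close>)
    ultimately show ?case by simp
  qed
  have "P (\<Sum>k\<in>K. Poly_Mapping.single k (Poly_Mapping.lookup f k)) \<and>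
      (\<Sum>k\<in>K. Poly_Mapping.single k (Poly_Mapping.lookup f k)) \<in> polys_in B"
    if "finite K" "\<forall>k\<in>K. Poly_Mapping.keys k \<subseteq> B" for K
    using that
  proof (induction K rule: finite_induct)
    case empty
    then show ?case using c[of 0] by (simp add: polys_in_def)
  next
    case (insert k K)
    have "Poly_Mapping.single k (Poly_Mapping.lookup f k)
      = const (Poly_Mapping.lookup f k) * Poly_Mapping.single k 1"
      by (simp add: mult_single)
    moreover have "P (const (Poly_Mapping.lookup f k) * Poly_Mapping.single k 1)"
      by (rule m[OF _ _ c mon]) (use insert.prems in \<open>auto simp: polys_in_def\<close>)
    ultimately have P: "P (Poly_Mapping.single k (Poly_Mapping.lookup f k))" by simp
    have s: "Poly_Mapping.single k (Poly_Mapping.lookup f k) \<in> polys_in B"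
      using insert.prems by (auto simp: polys_in_def)
    let ?S = "\<Sum>k\<in>K. Poly_Mapping.single k (Poly_Mapping.lookup f k)"
    have S: "P ?S" "?S \<in> polys_in B" using insert.IH insert.prems by auto
    have "Poly_Mapping.single k (Poly_Mapping.lookup f k) + ?S \<in> polys_in B"
      by (rule polys_add[OF s S(2)])
    moreover have "P (Poly_Mapping.single k (Poly_Mapping.lookup f k) + ?S)"
      by (rule a[OF s S(2) P S(1)])
    ultimately show ?case using insert.hyps by simp
  qed
  from conjunct1[OF this[of "Poly_Mapping.keys f"]] f
  have "P (\<Sum>k\<in>Poly_Mapping.keys f. Poly_Mapping.single k (Poly_Mapping.lookup f k))"
    by (auto simp: polys_in_def)
  then show ?thesis by (rule back_subst[where P = P, OF _ spoly_expand[symmetric]])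
qed


lemmas spoly_induct [case_names const gen add mult] =
  polys_induct[of _ UNIV, OF polys_UNIV, simplified]

lemma der_mon_eq:
  assumes "finite A" "Poly_Mapping.keys m \<subseteq> A"
  shows "der_mon d m = (\<Sum>x\<in>A.
    Poly_Mapping.single (m - Poly_Mapping.single x 1) (of_nat (Poly_Mapping.lookup m x)) * d x)"
  unfolding der_mon_def using assms
  by (intro sum.mono_neutral_left) (auto simp: in_keys_iff)

lemma der_mon_add:
  "der_mon d (m + n) = Poly_Mapping.single m 1 * der_mon d n + Poly_Mapping.single n 1 * der_mon d m"
proof -
  let ?A = "Poly_Mapping.keys m \<union> Poly_Mapping.keys n"
  have *: "Poly_Mapping.single (a + b - Poly_Mapping.single x 1) (of_nat (Poly_Mapping.lookup b x))
     = Poly_Mapping.single a 1 * (Poly_Mapping.single (b - Poly_Mapping.single x 1)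
          (of_nat (Poly_Mapping.lookup b x)) :: spoly)" for a b :: mon and x
  proof (cases "Poly_Mapping.lookup b x = 0")
    case False
    then have "a + b - Poly_Mapping.single x 1 = a + (b - Poly_Mapping.single x 1)"
      by (intro poly_mapping_eqI) (auto simp: lookup_add lookup_minus lookup_single when_def)
    then show ?thesis by (simp add: mult_single)
  qed simp
  have "Poly_Mapping.single (m + n - Poly_Mapping.single x 1)
          (of_nat (Poly_Mapping.lookup (m + n) x)) * d x
     = Poly_Mapping.single m 1 * (Poly_Mapping.single (n - Poly_Mapping.single x 1)
          (of_nat (Poly_Mapping.lookup n x)) * d x)
     + Poly_Mapping.single n 1 * (Poly_Mapping.single (m - Poly_Mapping.single x 1)
          (of_nat (Poly_Mapping.lookup m x)) * d x)" for x
    using *[of m n x] *[of n m x]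
    by (simp add: lookup_add single_add algebra_simps)
  then show ?thesis
    using keys_add[of m n]
    by (simp add: der_mon_eq[of ?A] sum.distrib sum_distrib_left)
qed

lemma der_add: "der d (f + g) = der d f + der d g"
  by (simp add: der_def lin_add)

lemma der_0 [simp]: "der d 0 = 0"
  by (simp add: der_def)

lemma der_uminus: "der d (- f) = - der d f"
  by (simp add: der_def lin_uminus)

lemma der_diff: "der d (f - g) = der d f - der d g"
  by (simp add: der_def lin_diff)

lemma der_sum: "der d (\<Sum>i\<in>I. f i) = (\<Sum>i\<in>I. der d (f i))"
  by (simp add: der_def lin_sum)

lemma der_const [simp]: "der d (const c) = 0"
  by (simp add: der_def lin_single der_mon_def)

lemma der_1 [simp]: "der d 1 = 0"
  using der_const[of d 1] by simp

lemma der_gen [simp]: "der d (gen x) = d x"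
  by (simp add: der_def gen_def lin_single der_mon_def)

lemma der_mult: "der d (f * g) = f * der d g + g * der d f"
proof -
  let ?m = "\<lambda>f m. Poly_Mapping.single m (Poly_Mapping.lookup f m) :: spoly"
  have s: "der d (Poly_Mapping.single m a * Poly_Mapping.single n b)
     = Poly_Mapping.single m a * der d (Poly_Mapping.single n b)
     + Poly_Mapping.single n b * der d (Poly_Mapping.single m a)" for m n a b
  proof -
    have e: "Poly_Mapping.single m a = const a * Poly_Mapping.single m 1"
      "Poly_Mapping.single n b = const b * Poly_Mapping.single n 1"
      by (simp_all add: mult_single)
    have d: "der d (Poly_Mapping.single k c) = const c * der_mon d k" for k c
      by (simp add: der_def lin_single)
    have "der d (Poly_Mapping.single m a * Poly_Mapping.single n b) = const a * const b *
      (Poly_Mapping.single m 1 * der_mon d n + Poly_Mapping.single n 1 * der_mon d m)"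
      by (simp add: d mult_single der_mon_add)
    then show ?thesis
      unfolding d by (subst e(1), subst e(2)) (simp only: algebra_simps)
  qed
  let ?F = "Poly_Mapping.keys f" and ?G = "Poly_Mapping.keys g"
  have "der d ((\<Sum>m\<in>?F. ?m f m) * (\<Sum>n\<in>?G. ?m g n))
      = (\<Sum>m\<in>?F. ?m f m) * der d (\<Sum>n\<in>?G. ?m g n) + (\<Sum>n\<in>?G. ?m g n) * der d (\<Sum>m\<in>?F. ?m f m)"
    by (simp add: sum_product der_sum s sum.distrib sum.swap[of _ ?F ?G])
  then show ?thesis unfolding spoly_expand[of f, symmetric] spoly_expand[of g, symmetric] .
qed

lemma der_unique:
  assumes f: "f \<in> polys_in B"
    and const: "\<And>c. D (const c) = 0"
    and gen: "\<And>x. x \<in> B \<Longrightarrow> D (gen x) = d x"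
    and add: "\<And>f g. f \<in> polys_in B \<Longrightarrow> g \<in> polys_in B \<Longrightarrow> D (f + g) = D f + D g"
    and mult: "\<And>f g. f \<in> polys_in B \<Longrightarrow> g \<in> polys_in B \<Longrightarrow> D (f * g) = f * D g + g * D f"
  shows "D f = der d f"
  using f by (induction f rule: polys_induct) (auto simp: assms der_add der_mult)

lemma der_polys:
  assumes "f \<in> polys_in B" "\<And>x. x \<in> B \<Longrightarrow> d x \<in> polys_in B"
  shows "der d f \<in> polys_in B"
  using assms by (induction f rule: polys_induct) (auto simp: der_add der_mult)

lemma der_add_vals: "der (\<lambda>x. a x + b x) f = der a f + der b f"
  by (rule der_unique[of f UNIV, symmetric])
     (auto simp: der_add der_mult algebra_simps)

lemma der_mult_vals: "der (\<lambda>x. c * a x) f = c * der a f"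
  by (rule der_unique[of f UNIV, symmetric])
     (auto simp: der_add der_mult algebra_simps)

lemma der_0_vals: "der (\<lambda>x. 0) f = 0"
  using der_mult_vals[of 0 "\<lambda>_. 0" f] by simp

lemma poisson_gen: "poisson (gen x) (gen y) = lie x y"
  by (simp add: poisson_def)

lemma poisson_add_left: "poisson (f + f') g = poisson f g + poisson f' g"
  by (simp add: poisson_def der_add)

lemma poisson_add_right: "poisson f (g + g') = poisson f g + poisson f g'"
  by (simp add: poisson_def der_add der_add_vals)

lemma poisson_mult_left: "poisson (f * f') g = f * poisson f' g + f' * poisson f g"
  by (simp add: poisson_def der_mult)

lemma poisson_mult_right: "poisson f (g * g') = g * poisson f g' + g' * poisson f g"
  by (simp add: poisson_def der_mult der_add_vals der_mult_vals)

lemma poisson_const_left [simp]: "poisson (const c) g = 0"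
  by (simp add: poisson_def)

lemma poisson_const_right [simp]: "poisson f (const c) = 0"
  by (simp add: poisson_def der_0_vals)

lemma poisson_0_left [simp]: "poisson 0 g = 0"
  by (simp add: poisson_def)

lemma poisson_0_right [simp]: "poisson f 0 = 0"
  by (simp add: poisson_def der_0_vals)

lemma poisson_uminus_left: "poisson (- f) g = - poisson f g"
  by (simp add: poisson_def der_uminus)

lemma poisson_diff_left: "poisson (f - f') g = poisson f g - poisson f' g"
  by (simp add: poisson_def der_diff)

lemma poisson_uminus_right: "poisson f (- g) = - poisson f g"
  using poisson_add_right[of f g "- g"] by (simp add: eq_neg_iff_add_eq_0 add.commute)

lemma poisson_diff_right: "poisson f (g - g') = poisson f g - poisson f g'"
  using poisson_add_right[of f g "- g'"] by (simp add: poisson_uminus_right)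

lemma poisson_sum_left: "poisson (\<Sum>i\<in>I. f i) g = (\<Sum>i\<in>I. poisson (f i) g)"
  by (simp add: poisson_def der_sum)

lemma poisson_sum_right: "poisson f (\<Sum>i\<in>I. g i) = (\<Sum>i\<in>I. poisson f (g i))"
  by (induction I rule: infinite_finite_induct) (auto simp: poisson_add_right)

lemma poisson_unique:
  assumes fg: "f \<in> symalg N L" "g \<in> symalg N L"
    and gen: "\<And>x y. x \<in> box N L \<Longrightarrow> y \<in> box N L \<Longrightarrow> B (gen x) (gen y) = lie x y"
    and const: "\<And>c f. f \<in> symalg N L \<Longrightarrow> B (const c) f = 0"
      "\<And>c f. f \<in> symalg N L \<Longrightarrow> B f (const c) = 0"
    and add: "\<And>f g h. f \<in> symalg N L \<Longrightarrow> g \<in> symalg N L \<Longrightarrow> h \<in> symalg N L \<Longrightarrow>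
        B (f + g) h = B f h + B g h"
      "\<And>f g h. f \<in> symalg N L \<Longrightarrow> g \<in> symalg N L \<Longrightarrow> h \<in> symalg N L \<Longrightarrow>
        B h (f + g) = B h f + B h g"
    and mult: "\<And>f g h. f \<in> symalg N L \<Longrightarrow> g \<in> symalg N L \<Longrightarrow> h \<in> symalg N L \<Longrightarrow>
        B (f * g) h = f * B g h + g * B f h"
      "\<And>f g h. f \<in> symalg N L \<Longrightarrow> g \<in> symalg N L \<Longrightarrow> h \<in> symalg N L \<Longrightarrow>
        B h (f * g) = f * B h g + g * B h f"
  shows "B f g = poisson f g"
  using fg(1)
proof (induction f rule: polys_induct)
  case (gen x)
  then have x: "gen x \<in> symalg N L" by simp
  show ?case using fg(2)
    by (induction g rule: polys_induct)
       (use gen x in \<open>auto simp: assms poisson_gen poisson_add_right poisson_mult_right\<close>)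
qed (use fg in \<open>auto simp: assms poisson_add_left poisson_mult_left\<close>)

lemma lie_symalg: "x \<in> box N L \<Longrightarrow> y \<in> box N L \<Longrightarrow> lie x y \<in> symalg N L"
  by (cases x; cases y) (auto simp: box_def)

lemma poisson_symalg: "f \<in> symalg N L \<Longrightarrow> g \<in> symalg N L \<Longrightarrow> poisson f g \<in> symalg N L"
  unfolding poisson_def by (intro der_polys) (auto intro: lie_symalg)

lemma lie_skew: "lie x y = - lie y x"
  by (cases x; cases y) auto

lemma poisson_skew: "poisson f g = - poisson g f"
proof (induction f rule: spoly_induct)
  case (gen x)
  show ?case
    by (induction g rule: spoly_induct)
       (auto simp: poisson_gen poisson_add_left poisson_add_right poisson_mult_left
          poisson_mult_right lie_skew[of x] algebra_simps)
qed (auto simp: poisson_add_left poisson_add_right poisson_mult_left poisson_mult_right algebra_simps)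

lemma poisson_jacobi_gen:
  "poisson (gen x) (lie y z) = poisson (lie x y) (gen z) + poisson (gen y) (lie x z)"
  by (cases x; cases y; cases z)
     (auto simp: poisson_gen poisson_diff_left poisson_diff_right poisson_uminus_left
        poisson_uminus_right)

lemma poisson_jacobi_aux:
  assumes "\<And>x y. poisson h (lie x y) = poisson (poisson h (gen x)) (gen y) + poisson (gen x) (poisson h (gen y))"
  shows "poisson h (poisson f g) = poisson (poisson h f) g + poisson f (poisson h g)"
proof (induction f rule: spoly_induct)
  case (gen x)
  show ?case
    by (induction g rule: spoly_induct)
       (auto simp: assms poisson_gen poisson_add_left poisson_add_right poisson_mult_left
          poisson_mult_right algebra_simps)
qed (auto simp: poisson_add_left poisson_add_right poisson_mult_left poisson_mult_right algebra_simps)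

lemma poisson_jacobi: "poisson h (poisson f g) = poisson (poisson h f) g + poisson f (poisson h g)"
proof (induction h rule: spoly_induct)
  case (gen x)
  show ?case
    by (rule poisson_jacobi_aux) (simp only: poisson_gen poisson_jacobi_gen[of x])
next
  case (mult h h')
  then show ?case
    by (simp add: poisson_add_left poisson_add_right poisson_mult_left poisson_mult_right
        poisson_skew[of f h] poisson_skew[of f h'] algebra_simps)
qed (auto simp: poisson_add_left poisson_add_right)

lemma poisson_as_der: "poisson h f = der (\<lambda>y. poisson h (gen y)) f"
  by (rule der_unique[of f UNIV]) (auto simp: poisson_add_right poisson_mult_right)


section \<open>The projections\<close>

lemma keys_add_mon: "Poly_Mapping.keys (m + n :: mon) = Poly_Mapping.keys m \<union> Poly_Mapping.keys n"
  by (auto simp: in_keys_iff lookup_add)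

definition cut :: "idx set \<Rightarrow> spoly \<Rightarrow> spoly" where
  "cut C = lin (\<lambda>m. if Poly_Mapping.keys m \<subseteq> C then Poly_Mapping.single m 1 else 0)"

lemma cut_0 [simp]: "cut C 0 = 0"
  by (simp add: cut_def)

lemma cut_add: "cut C (f + g) = cut C f + cut C g"
  by (simp add: cut_def lin_add)

lemma cut_diff: "cut C (f - g) = cut C f - cut C g"
  by (simp add: cut_def lin_diff)

lemma cut_uminus: "cut C (- f) = - cut C f"
  by (simp add: cut_def lin_uminus)

lemma cut_sum: "cut C (\<Sum>i\<in>I. f i) = (\<Sum>i\<in>I. cut C (f i))"
  by (simp add: cut_def lin_sum)

lemma cut_single: "cut C (Poly_Mapping.single m c) =
    (if Poly_Mapping.keys m \<subseteq> C then Poly_Mapping.single m c else 0)"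
  by (simp add: cut_def lin_single mult_single)

lemma cut_const [simp]: "cut C (const c) = const c"
  by (simp add: cut_single)

lemma cut_1 [simp]: "cut C 1 = 1"
  using cut_const[of C 1] by simp

lemma cut_gen [simp]: "cut C (gen x) = (if x \<in> C then gen x else 0)"
  by (simp add: cut_single gen_def)

lemma cut_mult: "cut C (f * g) = cut C f * cut C g"
proof -
  let ?m = "\<lambda>f m. Poly_Mapping.single m (Poly_Mapping.lookup f m) :: spoly"
  have s: "cut C (Poly_Mapping.single m a * Poly_Mapping.single n b)
     = cut C (Poly_Mapping.single m a) * cut C (Poly_Mapping.single n b)" for m n a b
    by (simp add: mult_single cut_single keys_add_mon)
  let ?F = "Poly_Mapping.keys f" and ?G = "Poly_Mapping.keys g"
  have "cut C ((\<Sum>m\<in>?F. ?m f m) * (\<Sum>n\<in>?G. ?m g n))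
      = cut C (\<Sum>m\<in>?F. ?m f m) * cut C (\<Sum>n\<in>?G. ?m g n)"
    by (simp only: sum_product cut_sum s)
  then show ?thesis unfolding spoly_expand[of f, symmetric] spoly_expand[of g, symmetric] .
qed

lemma cut_prod: "cut C (\<Prod>i\<in>I. f i) = (\<Prod>i\<in>I. cut C (f i))"
  by (induction I rule: infinite_finite_induct) (auto simp: cut_mult)

lemma cut_polys: "cut C f \<in> polys_in C"
  unfolding cut_def lin_def by (intro polys_sum polys_mult) (auto intro: polys_single)

lemma cut_id: "f \<in> polys_in C \<Longrightarrow> cut C f = f"
  by (induction f rule: polys_induct) (auto simp: cut_add cut_mult)

lemma cut_der_0:
  assumes "\<And>x. cut C (d x) = 0"
  shows "cut C (der d f) = 0"
  by (induction f rule: spoly_induct) (auto simp: der_add der_mult cut_add cut_mult assms)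

lemma poisson_diagE_gen:
  assumes "\<alpha> \<in> {1..L}"
  shows "poisson (diagE L k l) (E i j \<alpha>) =
    (if l = i then E k j \<alpha> else 0) - (if j = k then E i l \<alpha> else 0)"
proof -
  have "poisson (diagE L k l) (E i j \<alpha>) =
      (\<Sum>\<beta>\<in>{1..L}. if \<beta> = \<alpha> then (if l = i then E k j \<beta> else 0) - (if j = k then E i l \<beta> else 0) else 0)"
    unfolding diagE_def poisson_sum_left poisson_gen by (intro sum.cong) auto
  also have "\<dots> = (if l = i then E k j \<alpha> else 0) - (if j = k then E i l \<alpha> else 0)"
    using assms by (subst sum.delta) auto
  finally show ?thesis .
qed

lemma box_mono: "M \<le> N \<Longrightarrow> box M L \<subseteq> box N L"
  by (auto simp: box_def)

context
  notes One_nat_def [simp del]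
  fixes N L :: nat
  assumes N: "N \<ge> 1"
begin

lemma cut_poisson_ENN: "cut (box (N - 1) L) (poisson (E N N \<alpha>) g) = 0"
proof (subst poisson_as_der, rule cut_der_0)
  fix y
  show "cut (box (N - 1) L) (poisson (E N N \<alpha>) (gen y)) = 0"
    using N by (cases y) (auto simp: poisson_gen cut_diff cut_uminus box_def)
qed

lemma cut_poisson_diagE: "cut (box (N - 1) L) (poisson (diagE L N N) g) = 0"
  by (simp add: diagE_def poisson_sum_left cut_sum cut_poisson_ENN)

lemma cut_poisson_EiN:
  assumes "\<alpha> \<in> {1..L}" "g \<in> PNN N L"
  shows "cut (box (N - 1) L) (poisson (E i N \<alpha>) g) = 0"
proof (cases "i = N")
  case True
  then show ?thesis using cut_poisson_ENN by simp
next
  case False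
  then have "poisson (diagE L N N) (E i N \<alpha>) = - E i N \<alpha>"
    using assms by (simp add: poisson_diagE_gen)
  then have "poisson (diagE L N N) (poisson (E i N \<alpha>) g) = - poisson (E i N \<alpha>) g"
    using assms poisson_jacobi[of "diagE L N N" "E i N \<alpha>" g]
    by (simp add: PNN_def poisson_uminus_left)
  then show ?thesis
    using cut_poisson_diagE[of "poisson (E i N \<alpha>) g"] by (simp add: cut_uminus)
qed

lemma EiN_notin: "(i, N, \<alpha>) \<notin> box (N - 1) L"
  using N by (auto simp: box_def)

lemma cut_Iplus: "f \<in> Iplus N L \<Longrightarrow> cut (box (N - 1) L) f = 0"
  by (auto simp: Iplus_def cut_sum cut_mult EiN_notin)

lemma cut_poisson_Iplus:
  assumes "f \<in> Iplus N L" "g \<in> PNN N L"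
  shows "cut (box (N - 1) L) (poisson f g) = 0"
proof -
  obtain s where f: "f = (\<Sum>i\<in>{1..N}. \<Sum>\<alpha>\<in>{1..L}. s i \<alpha> * E i N \<alpha>)"
    using assms by (auto simp: Iplus_def)
  show ?thesis
    unfolding f poisson_sum_left cut_sum
    using cut_poisson_EiN[OF _ assms(2)]
    by (intro sum.neutral ballI) (simp add: poisson_mult_left cut_add cut_mult EiN_notin)
qed

lemma Iplus_single:
  assumes "s \<in> symalg N L" "(i, N, \<alpha>) \<in> box N L"
  shows "s * E i N \<alpha> \<in> Iplus N L"
proof -
  let ?s = "\<lambda>j \<beta>. if j = i then if \<beta> = \<alpha> then s else 0 else 0"
  have "?s j \<beta> * E j N \<beta> = (if j = i then if \<beta> = \<alpha> then s * E i N \<alpha> else 0 else 0)" for j \<beta>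
    by simp
  then have "(\<Sum>j\<in>{1..N}. \<Sum>\<beta>\<in>{1..L}. ?s j \<beta> * E j N \<beta>)
      = (\<Sum>j\<in>{1..N}. \<Sum>\<beta>\<in>{1..L}. if j = i then if \<beta> = \<alpha> then s * E i N \<alpha> else 0 else 0)"
    by presburger
  also have "\<dots> = (\<Sum>j\<in>{1..N}. if j = i then \<Sum>\<beta>\<in>{1..L}. if \<beta> = \<alpha> then s * E i N \<alpha> else 0 else 0)"
    by (intro sum.cong refl) simp
  also have "\<dots> = s * E i N \<alpha>"
    using assms by (simp add: sum.delta box_def)
  finally have "s * E i N \<alpha> = (\<Sum>j\<in>{1..N}. \<Sum>\<beta>\<in>{1..L}. ?s j \<beta> * E j N \<beta>)" ..
  moreover have "\<forall>j \<beta>. ?s j \<beta> \<in> symalg N L" using assms by auto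
  ultimately show ?thesis unfolding Iplus_def by (intro CollectI exI[of _ ?s] conjI)
qed

lemma Iplus_add:
  assumes "f \<in> Iplus N L" "g \<in> Iplus N L"
  shows "f + g \<in> Iplus N L"
proof -
  obtain s t where "f = (\<Sum>i\<in>{1..N}. \<Sum>\<alpha>\<in>{1..L}. s i \<alpha> * E i N \<alpha>)" "\<forall>i \<alpha>. s i \<alpha> \<in> symalg N L"
    "g = (\<Sum>i\<in>{1..N}. \<Sum>\<alpha>\<in>{1..L}. t i \<alpha> * E i N \<alpha>)" "\<forall>i \<alpha>. t i \<alpha> \<in> symalg N L"
    using assms by (auto simp: Iplus_def)
  then have "f + g = (\<Sum>i\<in>{1..N}. \<Sum>\<alpha>\<in>{1..L}. (s i \<alpha> + t i \<alpha>) * E i N \<alpha>)"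
      "\<forall>i \<alpha>. s i \<alpha> + t i \<alpha> \<in> symalg N L"
    by (auto simp: sum.distrib distrib_right)
  then show ?thesis unfolding Iplus_def
    by (intro CollectI exI[of _ "\<lambda>i \<alpha>. s i \<alpha> + t i \<alpha>"]) auto
qed

lemma Iplus_0: "0 \<in> Iplus N L"
  unfolding Iplus_def by (intro CollectI exI[of _ "\<lambda>_ _. 0"]) auto

lemma Iplus_sum: "(\<And>i. i \<in> I \<Longrightarrow> f i \<in> Iplus N L) \<Longrightarrow> (\<Sum>i\<in>I. f i) \<in> Iplus N L"
  by (induction I rule: infinite_finite_induct) (auto intro: Iplus_add Iplus_0)

lemma poisson_diagE_single:
  assumes "Poly_Mapping.keys m \<subseteq> box N L"
  shows "poisson (diagE L N N) (Poly_Mapping.single m c) = Poly_Mapping.single m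
    (c * of_int (\<Sum>x\<in>Poly_Mapping.keys m. int (Poly_Mapping.lookup m x) *
       ((if fst x = N then 1 else 0) - (if fst (snd x) = N then 1 else 0))))"
proof -
  define wt :: "idx \<Rightarrow> int" where
    "wt = (\<lambda>x. (if fst x = N then 1 else 0) - (if fst (snd x) = N then 1 else 0))"
  have "Poly_Mapping.single (m - Poly_Mapping.single x 1) (of_nat (Poly_Mapping.lookup m x)) *
        poisson (diagE L N N) (gen x)
      = Poly_Mapping.single m (of_int (int (Poly_Mapping.lookup m x) * wt x))"
    if x: "x \<in> Poly_Mapping.keys m" for x
  proof -
    have "snd (snd x) \<in> {1..L}" using x assms by (cases x) (auto simp: box_def)
    then have "poisson (diagE L N N) (gen x) = const (of_int (wt x)) * gen x"
      by (cases x) (auto simp: poisson_diagE_gen wt_def single_uminus)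
    moreover have "m - Poly_Mapping.single x 1 + Poly_Mapping.single x 1 = m"
      using x by (intro poly_mapping_eqI)
        (auto simp: lookup_add lookup_minus lookup_single when_def in_keys_iff)
    ultimately show ?thesis by (simp add: gen_def mult_single del: single_of_int)
  qed
  then have "der_mon (\<lambda>y. poisson (diagE L N N) (gen y)) m
      = (\<Sum>x\<in>Poly_Mapping.keys m. Poly_Mapping.single m (of_int (int (Poly_Mapping.lookup m x) * wt x)))"
    unfolding der_mon_def by (intro sum.cong) auto
  also have "\<dots> = Poly_Mapping.single m (of_int (\<Sum>x\<in>Poly_Mapping.keys m. int (Poly_Mapping.lookup m x) * wt x))"
  proof -
    have "(\<Sum>x\<in>X. Poly_Mapping.single m (of_int (h x))) = Poly_Mapping.single m (of_int (\<Sum>x\<in>X. h x) :: complex)"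
      for X :: "idx set" and h
      by (induction X rule: infinite_finite_induct) (auto simp: single_add)
    then show ?thesis .
  qed
  finally show ?thesis
    by (subst poisson_as_der) (simp add: der_def lin_single mult_single wt_def)
qed

lemma PNN_keys:
  assumes f: "f \<in> PNN N L" and m: "m \<in> Poly_Mapping.keys f"
    and C: "\<not> Poly_Mapping.keys m \<subseteq> box (N - 1) L"
  shows "\<exists>i \<alpha>. (i, N, \<alpha>) \<in> Poly_Mapping.keys m"
proof (rule ccontr)
  assume neg: "\<not> ?thesis"
  let ?W = "\<lambda>m. \<Sum>x\<in>Poly_Mapping.keys m. int (Poly_Mapping.lookup m x) *
       ((if fst x = N then 1 else 0) - (if fst (snd x) = N then 1 else 0))"
  have B: "Poly_Mapping.keys k \<subseteq> box N L" if "k \<in> Poly_Mapping.keys f" for k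
    using f that by (auto simp: PNN_def polys_in_def)
  have "0 = poisson (diagE L N N) (\<Sum>k\<in>Poly_Mapping.keys f. Poly_Mapping.single k (Poly_Mapping.lookup f k))"
    using f unfolding spoly_expand[of f, symmetric] by (simp add: PNN_def)
  also have "\<dots> = (\<Sum>k\<in>Poly_Mapping.keys f. Poly_Mapping.single k (Poly_Mapping.lookup f k * of_int (?W k)))"
    unfolding poisson_sum_right by (intro sum.cong refl poisson_diagE_single B)
  finally have "Poly_Mapping.lookup \<dots> m = 0" by simp
  moreover have "Poly_Mapping.lookup (\<Sum>k\<in>Poly_Mapping.keys f. Poly_Mapping.single k (Poly_Mapping.lookup f k * of_int (?W k))) m
      = Poly_Mapping.lookup f m * of_int (?W m)"
    using m by (simp only: lookup_sum lookup_single when_def) (subst sum.delta; simp)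
  ultimately have W: "?W m = 0" using m by (simp add: in_keys_iff del: of_int_sum)
  from C B[OF m] obtain x where x: "x \<in> Poly_Mapping.keys m" "x \<in> box N L" "x \<notin> box (N - 1) L" by blast
  have *: "fst (snd y) \<noteq> N" if "y \<in> Poly_Mapping.keys m" for y
    using neg that by (cases y) auto
  have xN: "fst x = N"
    using x *[OF x(1)] by (cases x) (auto simp: box_def)
  have "int (Poly_Mapping.lookup m x) * ((if fst x = N then 1 else 0) - (if fst (snd x) = N then 1 else 0)) \<le> ?W m"
    using x * by (intro member_le_sum) auto
  moreover have "Poly_Mapping.lookup m x \<noteq> 0" using x by (simp add: in_keys_iff)
  ultimately show False using W xN *[OF x(1)] by simp
qed

lemma PNN_cut_Iplus:
  assumes f: "f \<in> PNN N L"
  shows "f - cut (box (N - 1) L) f \<in> Iplus N L"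
proof -
  let ?C = "box (N - 1) L"
  have s: "Poly_Mapping.single m c - cut ?C (Poly_Mapping.single m c) \<in> Iplus N L"
    if m: "m \<in> Poly_Mapping.keys f" for m c
  proof (cases "Poly_Mapping.keys m \<subseteq> ?C")
    case True
    then show ?thesis by (simp add: cut_single Iplus_0)
  next
    case False
    then obtain i \<alpha> where x: "(i, N, \<alpha>) \<in> Poly_Mapping.keys m" using PNN_keys[OF f m] by blast
    have B: "Poly_Mapping.keys m \<subseteq> box N L" using f m by (auto simp: PNN_def polys_in_def)
    let ?x = "Poly_Mapping.single (i, N, \<alpha>) 1 :: mon"
    have "m - ?x + ?x = m"
      using x by (intro poly_mapping_eqI)
        (auto simp: lookup_add lookup_minus lookup_single when_def in_keys_iff)
    then have "Poly_Mapping.single m c = Poly_Mapping.single (m - ?x) c * E i N \<alpha>"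
      by (simp add: gen_def mult_single)
    moreover have "Poly_Mapping.single (m - ?x) c \<in> symalg N L"
      using B by (intro polys_single) (auto simp: in_keys_iff lookup_minus)
    ultimately have "Poly_Mapping.single m c \<in> Iplus N L"
      using Iplus_single x B by auto
    then show ?thesis using False by (simp add: cut_single)
  qed
  let ?S = "\<Sum>m\<in>Poly_Mapping.keys f. Poly_Mapping.single m (Poly_Mapping.lookup f m)"
  have "?S - cut ?C ?S \<in> Iplus N L"
    unfolding cut_sum sum_subtractf[symmetric] by (intro Iplus_sum s)
  then show ?thesis unfolding spoly_expand[of f, symmetric] .
qed

lemma symalg_pred_PNN: "g \<in> symalg (N - 1) L \<Longrightarrow> g \<in> PNN N L"
proof -
  assume g: "g \<in> symalg (N - 1) L"
  have "poisson (diagE L N N) g = 0" using g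
  proof (induction g rule: polys_induct)
    case (gen x)
    then show ?case using N by (cases x) (auto simp: poisson_diagE_gen box_def)
  qed (auto simp: poisson_add_right poisson_mult_right)
  moreover have "g \<in> symalg N L" using g box_mono[of "N - 1" N L] polys_mono by auto
  ultimately show ?thesis by (simp add: PNN_def)
qed

lemma PNN_diff: "f \<in> PNN N L \<Longrightarrow> g \<in> PNN N L \<Longrightarrow> f - g \<in> PNN N L"
  by (auto simp: PNN_def poisson_diff_right)

lemma proj_cut:
  assumes "f \<in> PNN N L"
  shows "g \<in> symalg (N - 1) L \<and> f - g \<in> PNN N L \<inter> Iplus N L \<longleftrightarrow> g = cut (box (N - 1) L) f"
proof
  assume g: "g \<in> symalg (N - 1) L \<and> f - g \<in> PNN N L \<inter> Iplus N L"
  then have "cut (box (N - 1) L) (f - g) = 0" using cut_Iplus by simp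
  then show "g = cut (box (N - 1) L) f" using g by (simp add: cut_diff cut_id)
qed (use assms PNN_cut_Iplus PNN_diff symalg_pred_PNN cut_polys in auto)

lemma PNN_decomposition:
  "f \<in> PNN N L \<Longrightarrow> \<exists>!g. g \<in> symalg (N - 1) L \<and> f - g \<in> PNN N L \<inter> Iplus N L"
  using proj_cut by simp

lemma proj_eq: "f \<in> PNN N L \<Longrightarrow> proj N L f = cut (box (N - 1) L) f"
  unfolding proj_def using proj_cut by simp

lemma P0N_PNN: "f \<in> P0N N L \<Longrightarrow> f \<in> PNN N L"
  using N by (auto simp: P0N_def PNN_def)

lemma PNN_poisson: "f \<in> PNN N L \<Longrightarrow> g \<in> PNN N L \<Longrightarrow> poisson f g \<in> PNN N L"
  using poisson_jacobi[of "diagE L N N" f g] by (auto simp: PNN_def poisson_symalg)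

lemma proj_poisson:
  assumes f: "f \<in> PNN N L" and g: "g \<in> PNN N L"
  shows "proj N L (poisson f g) = poisson (proj N L f) (proj N L g)"
proof -
  let ?c = "cut (box (N - 1) L)"
  have 1: "?c (poisson h k) = ?c (poisson (?c h) k)" if "h \<in> PNN N L" "k \<in> PNN N L" for h k
    using cut_poisson_Iplus[OF PNN_cut_Iplus[OF that(1)] that(2)]
    by (simp add: poisson_diff_left cut_diff)
  have cf: "?c f \<in> PNN N L" using cut_polys symalg_pred_PNN by blast
  have "?c (poisson f g) = - ?c (poisson g (?c f))"
    using 1[OF f g] poisson_skew[of "?c f" g] by (simp add: cut_uminus)
  also have "\<dots> = ?c (poisson (?c f) (?c g))"
    using 1[OF g cf] poisson_skew[of "?c g" "?c f"] by (simp add: cut_uminus)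
  also have "\<dots> = poisson (?c f) (?c g)"
    by (intro cut_id poisson_symalg cut_polys)
  finally show ?thesis using f g by (simp add: proj_eq PNN_poisson)
qed

end


section \<open>The Poisson bracket of the limit\<close>

definition mdeg :: "mon \<Rightarrow> nat" where
  "mdeg m = (\<Sum>x\<in>Poly_Mapping.keys m. Poly_Mapping.lookup m x)"

lemma mdeg_eq: "finite A \<Longrightarrow> Poly_Mapping.keys m \<subseteq> A \<Longrightarrow> mdeg m = (\<Sum>x\<in>A. Poly_Mapping.lookup m x)"
  unfolding mdeg_def by (intro sum.mono_neutral_left) (auto simp: in_keys_iff)

lemma mdeg_add: "mdeg (m + n) = mdeg m + mdeg n"
  by (simp add: mdeg_eq[of "Poly_Mapping.keys m \<union> Poly_Mapping.keys n"] keys_add_mon lookup_add sum.distrib)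

lemma mdeg_minus: "mdeg (m - n) \<le> mdeg m"
proof -
  have "Poly_Mapping.keys (m - n) \<subseteq> Poly_Mapping.keys m" by (auto simp: in_keys_iff lookup_minus)
  then show ?thesis
    by (auto simp: mdeg_eq[of "Poly_Mapping.keys m"] lookup_minus intro!: sum_mono)
qed

lemma deg_le_iff: "deg_le d f \<longleftrightarrow> (\<forall>m\<in>Poly_Mapping.keys f. mdeg m \<le> d)"
  by (simp add: deg_le_def mdeg_def)

lemma deg_le_0 [simp]: "deg_le d 0"
  by (simp add: deg_le_iff)

lemma deg_le_mono: "deg_le d f \<Longrightarrow> d \<le> e \<Longrightarrow> deg_le e f"
  by (auto simp: deg_le_iff)

lemma deg_le_add: "deg_le d f \<Longrightarrow> deg_le d g \<Longrightarrow> deg_le d (f + g)"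
  using keys_add[of f g] unfolding deg_le_iff by blast

lemma deg_le_uminus: "deg_le d f \<Longrightarrow> deg_le d (- f)"
  by (auto simp: deg_le_iff in_keys_iff)

lemma deg_le_diff: "deg_le d f \<Longrightarrow> deg_le d g \<Longrightarrow> deg_le d (f - g)"
  using deg_le_add[of d f "- g"] by (auto simp: deg_le_uminus)

lemma deg_le_sum: "(\<And>i. i \<in> I \<Longrightarrow> deg_le d (f i)) \<Longrightarrow> deg_le d (\<Sum>i\<in>I. f i)"
  by (induction I rule: infinite_finite_induct) (auto simp: deg_le_add)

lemma deg_le_mult:
  assumes "deg_le d f" "deg_le e g"
  shows "deg_le (d + e) (f * g)"
  unfolding deg_le_iff
proof
  fix k assume "k \<in> Poly_Mapping.keys (f * g)"
  then obtain a b where "a \<in> Poly_Mapping.keys f" "b \<in> Poly_Mapping.keys g" "k = a + b"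
    using keys_mult[of f g] by blast
  then show "mdeg k \<le> d + e" using assms by (auto simp: deg_le_iff mdeg_add intro: add_mono)
qed

lemma deg_le_single: "mdeg m \<le> d \<Longrightarrow> deg_le d (Poly_Mapping.single m c)"
  by (auto simp: deg_le_iff)

lemma deg_le_const: "deg_le d (const c)"
  by (intro deg_le_single) (simp add: mdeg_def)

lemma deg_le_gen: "deg_le 1 (gen x)"
  unfolding gen_def by (intro deg_le_single) (simp add: mdeg_def)

lemma deg_le_der:
  assumes f: "deg_le k f" and d: "\<And>x. deg_le e (d x)"
  shows "deg_le (k + e) (der d f)"
  unfolding der_def lin_def der_mon_def
proof (intro deg_le_sum)
  fix m assume "m \<in> Poly_Mapping.keys f"
  then have m: "mdeg m \<le> k" using f by (auto simp: deg_le_iff)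
  have "deg_le (k + e) (\<Sum>x\<in>Poly_Mapping.keys m.
     Poly_Mapping.single (m - Poly_Mapping.single x 1) (of_nat (Poly_Mapping.lookup m x)) * d x)"
    by (intro deg_le_sum deg_le_mult deg_le_single d order.trans[OF mdeg_minus m])
  then show "deg_le (k + e) (const (Poly_Mapping.lookup f m) * (\<Sum>x\<in>Poly_Mapping.keys m.
     Poly_Mapping.single (m - Poly_Mapping.single x 1) (of_nat (Poly_Mapping.lookup m x)) * d x))"
    using deg_le_mult[OF deg_le_const[of 0]] by fastforce
qed

lemma deg_le_poisson:
  assumes "deg_le d f" "deg_le e g"
  shows "deg_le (d + (e + 1)) (poisson f g)"
proof -
  have "deg_le 1 (lie x y)" for x y
    by (cases x; cases y) (auto intro!: deg_le_diff deg_le_gen deg_le_uminus simp del: One_nat_def)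
  then show ?thesis unfolding poisson_def by (intro deg_le_der assms)
qed

lemma P0N_poisson: "f \<in> P0N N L \<Longrightarrow> g \<in> P0N N L \<Longrightarrow> poisson f g \<in> P0N N L"
  using poisson_jacobi[of _ f g] by (auto simp: P0N_def poisson_symalg)

lemma poisson_lim_P0:
  assumes F: "F \<in> P0 L" and G: "G \<in> P0 L"
  shows "poisson_lim F G \<in> P0 L"
proof -
  have "proj N L (poisson (F N) (G N)) = poisson (F (N - 1)) (G (N - 1))" if "N \<ge> 1" for N
  proof -
    have "F N \<in> PNN N L" "G N \<in> PNN N L"
      using F G P0N_PNN[OF that] by (auto simp: P0_def)
    from proj_poisson[OF that this] show ?thesis
      using F G that by (simp add: P0_def)
  qed
  moreover obtain d e where "\<forall>N. deg_le d (F N)" "\<forall>N. deg_le e (G N)"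
    using F G by (auto simp: P0_def)
  then have "\<forall>N. deg_le (d + (e + 1)) (poisson (F N) (G N))" using deg_le_poisson by blast
  ultimately show ?thesis
    using F G by (auto simp: P0_def poisson_lim_def P0N_poisson)
qed


section \<open>The generators\<close>

fun mt :: "nat \<Rightarrow> nat list \<Rightarrow> nat \<Rightarrow> nat \<Rightarrow> spoly" where
  "mt N [] i j = (if i = j then 1 else 0)"
| "mt N (\<alpha> # w) i j = (\<Sum>a\<in>{1..N}. E i a \<alpha> * mt N w a j)"

fun mpath :: "nat list \<Rightarrow> nat list \<Rightarrow> nat \<Rightarrow> spoly" where
  "mpath (\<alpha> # w) (a # as) j = E a (hd (as @ [j])) \<alpha> * mpath w as j"
| "mpath _ _ j = 1"

abbreviation tuples :: "nat \<Rightarrow> nat \<Rightarrow> nat list set" where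
  "tuples n N \<equiv> {a. length a = n \<and> set a \<subseteq> {1..N}}"

lemma finite_tuples [simp]: "finite (tuples n N)"
  using finite_lists_length_eq[of "{1..N}" n] by (simp add: conj_commute)

lemma tuples_nth:
  assumes "a \<in> tuples n N" "t < n"
  shows "a ! t \<in> {1..N}"
proof -
  have "t < length a" "set a \<subseteq> {1..N}" using assms by auto
  then show ?thesis using nth_mem[of t a] by blast
qed

lemma tuples_Suc: "tuples (Suc n) N = (\<lambda>(a, as). a # as) ` ({1..N} \<times> tuples n N)"
  by (auto simp: length_Suc_conv image_iff)

lemma mpath_prod:
  "length as = length w \<Longrightarrow> mpath w as j = (\<Prod>t<length w. E (as ! t) ((as @ [j]) ! Suc t) (w ! t))"
proof (induction w arbitrary: as)
  case (Cons \<alpha> w)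
  then obtain a as' where as: "as = a # as'" "length as' = length w" by (cases as) auto
  then show ?case
    by (simp add: Cons.IH prod.lessThan_Suc_shift hd_conv_nth del: prod.lessThan_Suc)
qed simp

lemma mt_mpath:
  assumes "i \<in> {1..N}" "j \<in> {1..N}"
  shows "mt N w i j = (\<Sum>as\<in>tuples (length w) N. if hd (as @ [j]) = i then mpath w as j else 0)"
  using assms(1)
proof (induction w arbitrary: i)
  case Nil
  have "tuples 0 N = {[]}" by auto
  then show ?case by (simp del: length_0_conv)
next
  case (Cons \<alpha> w)
  have hd: "hd (as @ [j]) \<in> {1..N}" if "as \<in> tuples (length w) N" for as
    using that assms by (cases as) auto
  have "(\<Sum>as\<in>tuples (length (\<alpha> # w)) N. if hd (as @ [j]) = i then mpath (\<alpha> # w) as j else 0)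
     = (\<Sum>(a, as)\<in>{1..N} \<times> tuples (length w) N. if a = i then E a (hd (as @ [j])) \<alpha> * mpath w as j else 0)"
    unfolding length_Cons tuples_Suc
    by (subst sum.reindex) (auto simp: inj_on_def case_prod_unfold intro!: sum.cong)
  also have "\<dots> = (\<Sum>a\<in>{1..N}. if a = i then \<Sum>as\<in>tuples (length w) N. E a (hd (as @ [j])) \<alpha> * mpath w as j else 0)"
    unfolding sum.cartesian_product[symmetric] by (intro sum.cong) auto
  also have "\<dots> = (\<Sum>as\<in>tuples (length w) N. E i (hd (as @ [j])) \<alpha> * mpath w as j)"
    using Cons.prems by (subst sum.delta) auto
  also have "\<dots> = (\<Sum>as\<in>tuples (length w) N. \<Sum>b\<in>{1..N}. if hd (as @ [j]) = b then E i b \<alpha> * mpath w as j else 0)"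
    by (intro sum.cong refl) (use hd in \<open>auto simp: sum.delta'\<close>)
  also have "\<dots> = (\<Sum>b\<in>{1..N}. \<Sum>as\<in>tuples (length w) N. if hd (as @ [j]) = b then E i b \<alpha> * mpath w as j else 0)"
    by (rule sum.swap)
  also have "\<dots> = (\<Sum>b\<in>{1..N}. E i b \<alpha> * mt N w b j)"
    by (intro sum.cong refl) (auto simp: Cons.IH sum_distrib_left intro!: sum.cong)
  finally show ?case by simp
qed

lemma pword_mt:
  assumes "w \<noteq> []"
  shows "pword w N = (\<Sum>i\<in>{1..N}. mt N w i i)"
proof -
  have ne: "as \<noteq> []" if "as \<in> tuples (length w) N" for as using that assms by auto
  have "(\<Sum>i\<in>{1..N}. mt N w i i)
      = (\<Sum>i\<in>{1..N}. \<Sum>as\<in>tuples (length w) N. if hd (as @ [i]) = i then mpath w as i else 0)"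
    by (intro sum.cong refl mt_mpath) auto
  also have "\<dots> = (\<Sum>as\<in>tuples (length w) N. \<Sum>i\<in>{1..N}. if hd as = i then mpath w as i else 0)"
    by (subst sum.swap) (use ne in \<open>auto intro!: sum.cong\<close>)
  also have "\<dots> = (\<Sum>as\<in>tuples (length w) N. mpath w as (hd as))"
  proof (intro sum.cong refl)
    fix as assume as: "as \<in> tuples (length w) N"
    then have "hd as \<in> {1..N}" using ne[OF as] by (cases as) auto
    then show "(\<Sum>i\<in>{1..N}. if hd as = i then mpath w as i else 0) = mpath w as (hd as)"
      by (subst sum.delta') auto
  qed
  also have "\<dots> = pword w N"
    unfolding pword_def
  proof (intro sum.cong refl)
    fix as assume as: "as \<in> tuples (length w) N"
    have "(as @ [hd as]) ! Suc t = as ! (Suc t mod length w)" if "t < length w" for t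
      using as that ne[OF as] by (cases "Suc t = length w") (auto simp: nth_append hd_conv_nth)
    then show "mpath w as (hd as) = (\<Prod>t<length w. E (as ! t) (as ! (Suc t mod length w)) (w ! t))"
      using as by (subst mpath_prod) (auto intro!: prod.cong)
  qed
  finally show ?thesis ..
qed

lemma mt_append:
  assumes "i \<in> {1..N}"
  shows "mt N (u @ v) i j = (\<Sum>b\<in>{1..N}. mt N u i b * mt N v b j)"
  using assms
proof (induction u arbitrary: i)
  case Nil
  have "(\<Sum>b\<in>{1..N}. mt N [] i b * mt N v b j) = (\<Sum>b\<in>{1..N}. if i = b then mt N v b j else 0)"
    by (intro sum.cong) auto
  then show ?case using Nil by (simp add: sum.delta')
next
  case (Cons \<alpha> u)
  have "mt N ((\<alpha> # u) @ v) i j = (\<Sum>a\<in>{1..N}. \<Sum>b\<in>{1..N}. E i a \<alpha> * (mt N u a b * mt N v b j))"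
    by (simp add: Cons.IH sum_distrib_left)
  also have "\<dots> = (\<Sum>b\<in>{1..N}. \<Sum>a\<in>{1..N}. E i a \<alpha> * (mt N u a b * mt N v b j))"
    by (rule sum.swap)
  finally show ?case by (simp add: sum_distrib_right mult.assoc)
qed

lemma pword_append_commute: "pword (u @ v) N = pword (v @ u) N"
proof (cases "u @ v = []")
  case False
  then have "v @ u \<noteq> []" by auto
  have "pword (u @ v) N = (\<Sum>i\<in>{1..N}. \<Sum>b\<in>{1..N}. mt N u i b * mt N v b i)"
    using False by (simp add: pword_mt mt_append)
  also have "\<dots> = (\<Sum>b\<in>{1..N}. \<Sum>i\<in>{1..N}. mt N v b i * mt N u i b)"
    by (subst sum.swap) (simp add: mult.commute)
  also have "\<dots> = pword (v @ u) N"
    using \<open>v @ u \<noteq> []\<close> by (simp add: pword_mt mt_append)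
  finally show ?thesis .
qed simp

lemma pword_rotate: "pword (rotate k w) = pword w"
proof
  fix N
  show "pword (rotate k w) N = pword w N"
    unfolding rotate_drop_take by (subst pword_append_commute) simp
qed

theorem pgen_circ: "pgen (circ w) = pword w"
proof -
  have "w \<in> circ w" unfolding circ_def by (auto intro: exI[of _ 0])
  then have "(SOME v. v \<in> circ w) \<in> circ w" by (rule someI)
  then show ?thesis by (auto simp: pgen_def circ_def pword_rotate)
qed

lemma poisson_diagE_mt:
  assumes "set w \<subseteq> {1..L}" "k \<in> {1..N}" "l \<in> {1..N}" "i \<in> {1..N}"
  shows "poisson (diagE L k l) (mt N w i j) =
    (if l = i then mt N w k j else 0) - (if j = k then mt N w i l else 0)"
  using assms
proof (induction w arbitrary: i)
  case Nil
  then show ?case using poisson_const_right[of "diagE L k l" 1] by auto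
next
  case (Cons \<alpha> w)
  then have \<alpha>: "\<alpha> \<in> {1..L}" by simp
  let ?D = "poisson (diagE L k l)"
  have "?D (E i a \<alpha> * mt N w a j) =
      (if l = i then E k a \<alpha> * mt N w a j else 0) - (if a = k then E i l \<alpha> * mt N w k j else 0)
    + (if a = l then E i l \<alpha> * mt N w k j else 0) - (if j = k then E i a \<alpha> * mt N w a l else 0)"
    if "a \<in> {1..N}" for a
  proof -
    have IH: "?D (mt N w a j) = (if l = a then mt N w k j else 0) - (if j = k then mt N w a l else 0)"
      using Cons that by auto
    show ?thesis
      unfolding poisson_mult_right poisson_diagE_gen[OF \<alpha>] IH by (auto simp: algebra_simps)
  qed
  then have "?D (mt N (\<alpha> # w) i j) =
     (\<Sum>a\<in>{1..N}. if l = i then E k a \<alpha> * mt N w a j else 0) - (\<Sum>a\<in>{1..N}. if a = k then E i l \<alpha> * mt N w k j else 0)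
    + (\<Sum>a\<in>{1..N}. if a = l then E i l \<alpha> * mt N w k j else 0) - (\<Sum>a\<in>{1..N}. if j = k then E i a \<alpha> * mt N w a l else 0)"
    by (simp add: poisson_sum_right sum.distrib sum_subtractf)
  then show ?case using Cons.prems by (simp add: sum.delta)
qed

lemma pword_P0N:
  assumes "w \<in> wrds L"
  shows "pword w N \<in> P0N N L"
proof -
  have w: "w \<noteq> []" "set w \<subseteq> {1..L}" using assms by (auto simp: wrds_def)
  have "pword w N \<in> symalg N L"
    unfolding pword_def
  proof (intro polys_sum polys_prod)
    fix a t assume a: "a \<in> tuples (length w) N" and t: "t \<in> {..<length w}"
    have m: "Suc t mod length w < length w" using w by simp
    have "w ! t \<in> {1..L}" using w t nth_mem[of t w] by blast
    moreover have "a ! t \<in> {1..N}" "a ! (Suc t mod length w) \<in> {1..N}"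
      using tuples_nth[OF a] t m by auto
    ultimately show "E (a ! t) (a ! (Suc t mod length w)) (w ! t) \<in> symalg N L"
      by (simp add: box_def)
  qed
  moreover have "poisson (diagE L k l) (pword w N) = 0" if "k \<in> {1..N}" "l \<in> {1..N}" for k l
  proof -
    have "poisson (diagE L k l) (pword w N) =
       (\<Sum>i\<in>{1..N}. (if l = i then mt N w k i else 0) - (if i = k then mt N w i l else 0))"
      using w that by (simp add: pword_mt poisson_sum_right poisson_diagE_mt)
    then show ?thesis using that by (simp add: sum_subtractf sum.delta sum.delta')
  qed
  ultimately show ?thesis by (simp add: P0N_def)
qed

lemma proj_pword:
  assumes w: "w \<in> wrds L" and N: "N \<ge> 1"
  shows "proj N L (pword w N) = pword w (N - 1)"
proof -
  let ?C = "box (N - 1) L"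
  have "cut ?C (pword w N) = (\<Sum>a\<in>tuples (length w) N.
     \<Prod>t<length w. cut ?C (E (a ! t) (a ! (Suc t mod length w)) (w ! t)))"
    by (simp add: pword_def cut_sum cut_prod del: cut_gen)
  also have "\<dots> = (\<Sum>a\<in>tuples (length w) (N - 1).
     \<Prod>t<length w. E (a ! t) (a ! (Suc t mod length w)) (w ! t))"
  proof (intro sum.mono_neutral_cong_right ballI finite_tuples)
    show "tuples (length w) (N - 1) \<subseteq> tuples (length w) N" by fastforce
    fix a assume a: "a \<in> tuples (length w) N - tuples (length w) (N - 1)"
    then have "\<not> set a \<subseteq> {1..N - 1}" by auto
    then obtain x where x: "x \<in> set a" "x \<notin> {1..N - 1}" by blast
    then obtain t where t: "t < length w" "a ! t \<notin> {1..N - 1}"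
      using a by (auto simp: in_set_conv_nth)
    then have "cut ?C (E (a ! t) (a ! (Suc t mod length w)) (w ! t)) = 0"
      by (auto simp: box_def)
    then show "(\<Prod>t<length w. cut ?C (E (a ! t) (a ! (Suc t mod length w)) (w ! t))) = 0"
      using t(1) by (intro prod_zero bexI[of _ t]) (simp_all del: cut_gen)
  next
    fix a assume a: "a \<in> tuples (length w) (N - 1)"
    show "(\<Prod>t<length w. cut ?C (E (a ! t) (a ! (Suc t mod length w)) (w ! t))) =
      (\<Prod>t<length w. E (a ! t) (a ! (Suc t mod length w)) (w ! t))"
    proof (intro prod.cong refl)
      fix t assume t: "t \<in> {..<length w}"
      have m: "Suc t mod length w < length w" using w by (simp add: wrds_def)
      have "w ! t \<in> {1..L}" using w t nth_mem[of t w] unfolding wrds_def by blast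
      moreover have "a ! t \<in> {1..N - 1}" "a ! (Suc t mod length w) \<in> {1..N - 1}"
        using tuples_nth[OF a] t m by auto
      ultimately show "cut ?C (E (a ! t) (a ! (Suc t mod length w)) (w ! t))
          = E (a ! t) (a ! (Suc t mod length w)) (w ! t)"
        by (simp add: box_def)
    qed
  qed
  finally show ?thesis
    using proj_eq[OF N P0N_PNN[OF N pword_P0N[OF w]]] by (simp add: pword_def)
qed

lemma deg_le_pword: "deg_le (length w) (pword w N)"
proof -
  have "deg_le n (\<Prod>t<n. gen (h t))" for h and n :: nat
  proof (induction n)
    case 0
    show ?case using deg_le_const[of 0 1] by simp
  next
    case (Suc n)
    then show ?case using deg_le_mult[OF Suc deg_le_gen[of "h n"]] by simp
  qed
  then show ?thesis unfolding pword_def by (intro deg_le_sum)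
qed

theorem pgen_P0: "c \<in> cwrds L \<Longrightarrow> pgen c \<in> P0 L"
proof -
  assume "c \<in> cwrds L"
  then obtain w where w: "w \<in> wrds L" "c = circ w" by (auto simp: cwrds_def)
  have "\<exists>d. \<forall>N. deg_le d (pword w N)" using deg_le_pword by blast
  then show ?thesis using w by (auto simp: pgen_circ P0_def pword_P0N proj_pword)
qed

end

theory Submission
  imports Defs
begin

text \<open>Write \<open>p(w; N)\<close> as the trace of the product of the matrices \<open>(E\<^sub>i\<^sub>j\<^sub>|\<^sub>\<alpha>)\<^sub>i\<^sub>j\<close> along the letters \<open>\<alpha>\<close>
  of \<open>w\<close>; the entries of such products are \<open>mt\<close>. By the Leibniz rule, a derivation applied to
  a trace acts on one letter at a time, and by cyclicity of the trace the remaining letters form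
  the word obtained by cutting the circular word at that letter (\<open>der_pword\<close>). The Poisson
  bracket is a derivation in each argument, so \<open>{p(z), p(w)}\<close> is a sum over pairs of positions
  \<open>(r, q)\<close>. With \<open>Z\<close> and \<open>W\<close> the matrix products of the two cut words, such a pair contributes
  the bracket of two matrix units contracted with \<open>Z\<close> and \<open>W\<close>. Each of the two terms of
  \<open>[E\<^sub>a\<^sub>b, E\<^sub>c\<^sub>d] = \<delta>\<^sub>b\<^sub>c E\<^sub>a\<^sub>d - \<delta>\<^sub>d\<^sub>a E\<^sub>c\<^sub>b\<close> glues the two cut words into a single trace, with the
  common letter inserted at one or the other of the two junctions (\<open>lie_contraction\<close>). The
  identity holds at every level \<open>N\<close>, hence in the limit.\<close>

lemma der_mt:
  assumes "i \<in> {1..N}"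
  shows "der d (mt N z i j) = (\<Sum>r<length z. \<Sum>a\<in>{1..N}. \<Sum>b\<in>{1..N}.
    mt N (take r z) i a * mt N (drop (Suc r) z) b j * d (a, b, z ! r))"
  using assms
proof (induction z arbitrary: i)
  case Nil
  then show ?case by simp
next
  case (Cons \<alpha> z)
  let ?T = "\<lambda>i r a b. mt N (take r z) i a * mt N (drop (Suc r) z) b j * d (a, b, z ! r)"
  have first: "(\<Sum>a\<in>{1..N}. \<Sum>b\<in>{1..N}. mt N [] i a * mt N z b j * d (a, b, \<alpha>))
      = (\<Sum>b\<in>{1..N}. mt N z b j * d (i, b, \<alpha>))"
  proof -
    have "(\<Sum>a\<in>{1..N}. \<Sum>b\<in>{1..N}. mt N [] i a * mt N z b j * d (a, b, \<alpha>))
      = (\<Sum>a\<in>{1..N}. if i = a then \<Sum>b\<in>{1..N}. mt N z b j * d (a, b, \<alpha>) else 0)"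
      by (intro sum.cong) auto
    then show ?thesis using Cons.prems by (simp add: sum.delta')
  qed
  have rest: "(\<Sum>a\<in>{1..N}. \<Sum>b\<in>{1..N}. mt N (\<alpha> # take r z) i a * mt N (drop (Suc r) z) b j
        * d (a, b, z ! r))
      = (\<Sum>e\<in>{1..N}. E i e \<alpha> * (\<Sum>a\<in>{1..N}. \<Sum>b\<in>{1..N}. ?T e r a b))" for r
  proof -
    have "(\<Sum>a\<in>{1..N}. \<Sum>b\<in>{1..N}. mt N (\<alpha> # take r z) i a * mt N (drop (Suc r) z) b j
        * d (a, b, z ! r)) = (\<Sum>a\<in>{1..N}. \<Sum>b\<in>{1..N}. \<Sum>e\<in>{1..N}. E i e \<alpha> * ?T e r a b)"
      by (simp add: sum_distrib_right sum_distrib_left mult.assoc)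
    also have "\<dots> = (\<Sum>a\<in>{1..N}. \<Sum>e\<in>{1..N}. \<Sum>b\<in>{1..N}. E i e \<alpha> * ?T e r a b)"
      by (intro sum.cong refl sum.swap)
    also have "\<dots> = (\<Sum>e\<in>{1..N}. \<Sum>a\<in>{1..N}. \<Sum>b\<in>{1..N}. E i e \<alpha> * ?T e r a b)"
      by (rule sum.swap)
    finally show ?thesis by (simp add: sum_distrib_left)
  qed
  have "der d (mt N (\<alpha> # z) i j)
      = (\<Sum>e\<in>{1..N}. E i e \<alpha> * der d (mt N z e j)) + (\<Sum>e\<in>{1..N}. mt N z e j * d (i, e, \<alpha>))"
    by (simp add: der_sum der_mult sum.distrib)
  also have "(\<Sum>e\<in>{1..N}. E i e \<alpha> * der d (mt N z e j))
      = (\<Sum>e\<in>{1..N}. \<Sum>r<length z. E i e \<alpha> * (\<Sum>a\<in>{1..N}. \<Sum>b\<in>{1..N}. ?T e r a b))"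
    by (simp add: Cons.IH sum_distrib_left)
  also have "\<dots> = (\<Sum>r<length z. \<Sum>e\<in>{1..N}. E i e \<alpha> * (\<Sum>a\<in>{1..N}. \<Sum>b\<in>{1..N}. ?T e r a b))"
    by (rule sum.swap)
  finally show ?case
    by (simp only: length_Cons sum.lessThan_Suc_shift take_0 drop_Suc_Cons drop_0 nth_Cons_0
        nth_Cons_Suc take_Suc_Cons first rest add.commute)
qed

text \<open>The coefficient of \<open>d (a, b, z ! r)\<close> is the contribution of position \<open>r\<close> to the partial
  derivative of \<open>p(z; N)\<close> by the variable \<open>(a, b, z ! r)\<close>. Its indices are transposed because
  the product of the remaining letters, read cyclically after \<open>r\<close>, leads from \<open>b\<close> back to \<open>a\<close>.\<close>

lemma der_pword:
  assumes "z \<noteq> []"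
  shows "der d (pword z N) = (\<Sum>r<length z. \<Sum>a\<in>{1..N}. \<Sum>b\<in>{1..N}.
    mt N (drop (Suc r) z @ take r z) b a * d (a, b, z ! r))"
proof -
  let ?T = "\<lambda>i r a b. mt N (take r z) i a * mt N (drop (Suc r) z) b i * d (a, b, z ! r)"
  have "der d (pword z N) = (\<Sum>i\<in>{1..N}. \<Sum>r<length z. \<Sum>a\<in>{1..N}. \<Sum>b\<in>{1..N}. ?T i r a b)"
    using assms by (simp add: pword_mt der_sum der_mt)
  also have "\<dots> = (\<Sum>r<length z. \<Sum>i\<in>{1..N}. \<Sum>a\<in>{1..N}. \<Sum>b\<in>{1..N}. ?T i r a b)"
    by (rule sum.swap)
  also have "\<dots> = (\<Sum>r<length z. \<Sum>a\<in>{1..N}. \<Sum>i\<in>{1..N}. \<Sum>b\<in>{1..N}. ?T i r a b)"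
    by (intro sum.cong refl sum.swap)
  also have "\<dots> = (\<Sum>r<length z. \<Sum>a\<in>{1..N}. \<Sum>b\<in>{1..N}. \<Sum>i\<in>{1..N}. ?T i r a b)"
    by (intro sum.cong refl sum.swap)
  also have "\<dots> = (\<Sum>r<length z. \<Sum>a\<in>{1..N}. \<Sum>b\<in>{1..N}.
      mt N (drop (Suc r) z @ take r z) b a * d (a, b, z ! r))"
    by (intro sum.cong refl) (simp add: mt_append sum_distrib_left mult_ac)
  finally show ?thesis .
qed

lemma mt_letter:
  assumes "j \<in> {1..N}"
  shows "mt N [\<alpha>] i j = E i j \<alpha>"
proof -
  have "mt N [\<alpha>] i j = (\<Sum>a\<in>{1..N}. if j = a then E i a \<alpha> else 0)"
    unfolding mt.simps by (intro sum.cong) auto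
  then show ?thesis using assms by (simp add: sum.delta')
qed

lemma pword_insert_letter:
  "pword (u @ \<alpha> # v) N =
    (\<Sum>a\<in>{1..N}. \<Sum>b\<in>{1..N}. \<Sum>c\<in>{1..N}. mt N u b a * (mt N v c b * E a c \<alpha>))"
proof -
  have "mt N (\<alpha> # v) a b = (\<Sum>c\<in>{1..N}. mt N v c b * E a c \<alpha>)" for a b
    by (simp add: mult.commute)
  then have "pword (u @ \<alpha> # v) N =
      (\<Sum>b\<in>{1..N}. \<Sum>a\<in>{1..N}. \<Sum>c\<in>{1..N}. mt N u b a * (mt N v c b * E a c \<alpha>))"
    by (simp add: pword_mt mt_append sum_distrib_left del: mt.simps)
  then show ?thesis by (subst sum.swap)
qed

text \<open>For \<open>\<alpha> = \<beta>\<close>, let \<open>Z\<close>, \<open>W\<close> and \<open>X\<close> be the matrix products along \<open>u\<close>, \<open>v\<close> and \<open>[\<alpha>]\<close>. The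
  term \<open>\<delta>\<^sub>b\<^sub>c X\<^sub>a\<^sub>e\<close> of the commutator closes the indices to \<open>Z\<^sub>b\<^sub>a X\<^sub>a\<^sub>e W\<^sub>e\<^sub>b\<close>, and the term
  \<open>\<delta>\<^sub>e\<^sub>a X\<^sub>c\<^sub>b\<close> to \<open>Z\<^sub>b\<^sub>a W\<^sub>a\<^sub>c X\<^sub>c\<^sub>b\<close>, so the two traces are those of \<open>Z X W\<close> and \<open>Z W X\<close>.\<close>

lemma lie_contraction:
  "(\<Sum>a\<in>{1..N}. \<Sum>b\<in>{1..N}. mt N u b a *
      (\<Sum>c\<in>{1..N}. \<Sum>e\<in>{1..N}. mt N v e c * lie (a, b, \<alpha>) (c, e, \<beta>)))
    = (if \<alpha> = \<beta> then pword (u @ \<alpha> # v) N - pword (u @ v @ [\<alpha>]) N else 0)"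
proof (cases "\<alpha> = \<beta>")
  case True
  have inner: "(\<Sum>c\<in>{1..N}. \<Sum>e\<in>{1..N}. mt N v e c * lie (a, b, \<alpha>) (c, e, \<alpha>))
      = (\<Sum>e\<in>{1..N}. mt N v e b * E a e \<alpha>) - (\<Sum>c\<in>{1..N}. mt N v a c * E c b \<alpha>)"
    if ab: "a \<in> {1..N}" "b \<in> {1..N}" for a b
  proof -
    have "(\<Sum>c\<in>{1..N}. \<Sum>e\<in>{1..N}. mt N v e c * lie (a, b, \<alpha>) (c, e, \<alpha>))
      = (\<Sum>c\<in>{1..N}. \<Sum>e\<in>{1..N}. if b = c then mt N v e c * E a e \<alpha> else 0)
      - (\<Sum>c\<in>{1..N}. \<Sum>e\<in>{1..N}. if e = a then mt N v e c * E c b \<alpha> else 0)"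
      unfolding sum_subtractf[symmetric] by (intro sum.cong refl) (auto simp: algebra_simps)
    also have "(\<Sum>c\<in>{1..N}. \<Sum>e\<in>{1..N}. if b = c then mt N v e c * E a e \<alpha> else 0)
      = (\<Sum>c\<in>{1..N}. if b = c then \<Sum>e\<in>{1..N}. mt N v e c * E a e \<alpha> else 0)"
      by (intro sum.cong) auto
    finally show ?thesis using ab by (simp add: sum.delta sum.delta')
  qed
  have E: "(\<Sum>c\<in>{1..N}. mt N v a c * E c b \<alpha>) = mt N (v @ [\<alpha>]) a b"
    if "a \<in> {1..N}" "b \<in> {1..N}" for a b
    using that by (simp add: mt_append mt_letter del: mt.simps)
  have "(\<Sum>a\<in>{1..N}. \<Sum>b\<in>{1..N}. mt N u b a *
      (\<Sum>c\<in>{1..N}. \<Sum>e\<in>{1..N}. mt N v e c * lie (a, b, \<alpha>) (c, e, \<alpha>)))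
    = (\<Sum>a\<in>{1..N}. \<Sum>b\<in>{1..N}. mt N u b a * (\<Sum>e\<in>{1..N}. mt N v e b * E a e \<alpha>))
    - (\<Sum>a\<in>{1..N}. \<Sum>b\<in>{1..N}. mt N u b a * mt N (v @ [\<alpha>]) a b)"
    unfolding sum_subtractf[symmetric]
    by (intro sum.cong refl) (simp only: inner E right_diff_distrib)
  also have "(\<Sum>a\<in>{1..N}. \<Sum>b\<in>{1..N}. mt N u b a * mt N (v @ [\<alpha>]) a b) = pword (u @ v @ [\<alpha>]) N"
    by (subst sum.swap) (simp add: pword_mt mt_append[of _ N u])
  also have "(\<Sum>a\<in>{1..N}. \<Sum>b\<in>{1..N}. mt N u b a * (\<Sum>e\<in>{1..N}. mt N v e b * E a e \<alpha>))
    = pword (u @ \<alpha> # v) N"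
    by (simp only: pword_insert_letter sum_distrib_left)
  finally show ?thesis using True by simp
qed simp

theorem poisson_pword:
  assumes "z \<noteq> []" "w \<noteq> []"
  shows "poisson (pword z N) (pword w N) =
    (\<Sum>r<length z. \<Sum>q<length w. if z ! r = w ! q
       then pword (take r z @ [z ! r] @ drop (Suc q) w @ take q w @ drop (Suc r) z) N
          - pword (take r z @ drop (Suc q) w @ take q w @ [z ! r] @ drop (Suc r) z) N
       else 0)"
proof -
  let ?u = "\<lambda>r. drop (Suc r) z @ take r z" and ?v = "\<lambda>q. drop (Suc q) w @ take q w"
  let ?B = "\<lambda>r q a b. \<Sum>c\<in>{1..N}. \<Sum>e\<in>{1..N}. mt N (?v q) e c * lie (a, b, z ! r) (c, e, w ! q)"
  have "poisson (pword z N) (pword w N) =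
      (\<Sum>r<length z. \<Sum>a\<in>{1..N}. \<Sum>b\<in>{1..N}. \<Sum>q<length w. mt N (?u r) b a * ?B r q a b)"
    unfolding poisson_def by (simp only: der_pword assms sum_distrib_left not_False_eq_True)
  also have "\<dots> = (\<Sum>r<length z. \<Sum>a\<in>{1..N}. \<Sum>q<length w. \<Sum>b\<in>{1..N}. mt N (?u r) b a * ?B r q a b)"
    by (intro sum.cong refl sum.swap)
  also have "\<dots> = (\<Sum>r<length z. \<Sum>q<length w. \<Sum>a\<in>{1..N}. \<Sum>b\<in>{1..N}. mt N (?u r) b a * ?B r q a b)"
    by (intro sum.cong refl sum.swap)
  also have "\<dots> = (\<Sum>r<length z. \<Sum>q<length w. if z ! r = w ! q
      then pword (?u r @ z ! r # ?v q) N - pword (?u r @ ?v q @ [z ! r]) N else 0)"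
    by (simp only: lie_contraction)
  finally have expansion: "poisson (pword z N) (pword w N) =
      (\<Sum>r<length z. \<Sum>q<length w. if z ! r = w ! q
      then pword (?u r @ z ! r # ?v q) N - pword (?u r @ ?v q @ [z ! r]) N else 0)" .
  have first: "pword (?u r @ z ! r # ?v q) N =
      pword (take r z @ [z ! r] @ drop (Suc q) w @ take q w @ drop (Suc r) z) N" for r q
    using pword_append_commute[of "drop (Suc r) z" "take r z @ z ! r # ?v q" N] by simp
  have second: "pword (?u r @ ?v q @ [z ! r]) N =
      pword (take r z @ drop (Suc q) w @ take q w @ [z ! r] @ drop (Suc r) z) N" for r q
    using pword_append_commute[of "drop (Suc r) z" "take r z @ ?v q @ [z ! r]" N] by simp
  show ?thesis
    unfolding expansion first second ..
qed

lemma pgen_representative: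
  assumes "c \<in> cwrds L" "w \<in> c"
  shows "pgen c = pword w" "w \<noteq> []"
proof -
  obtain v where v: "v \<in> wrds L" "c = circ v"
    using assms(1) by (auto simp: cwrds_def)
  obtain k where "w = rotate k v"
    using assms(2) v(2) by (auto simp: circ_def)
  then show "pgen c = pword w" "w \<noteq> []"
    using v by (simp_all add: pgen_circ pword_rotate wrds_def)
qed

lemma sum_pointwise: "(\<Sum>i\<in>I. f i) x = (\<Sum>i\<in>I. f i x)"
  by (induction I rule: infinite_finite_induct) auto

theorem proposition5p4:
  fixes L :: nat and zc wc :: "nat list set" and z w :: "nat list"
  assumes "L \<ge> 2"
    and "zc \<in> cwrds L" and "wc \<in> cwrds L"
    and "z \<in> zc" and "w \<in> wc"
  shows "poisson_lim (pgen zc) (pgen wc) =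
    (\<Sum>r<length z. \<Sum>q<length w. if z ! r = w ! q
       then pgen (circ (take r z @ [z ! r] @ drop (Suc q) w @ take q w @ drop (Suc r) z))
          - pgen (circ (take r z @ drop (Suc q) w @ take q w @ [z ! r] @ drop (Suc r) z))
       else 0)"
proof
  fix N
  note z = pgen_representative[OF assms(2,4)] and w = pgen_representative[OF assms(3,5)]
  have if_pointwise: "(if b then f else 0) N = (if b then f N else 0)" for b and f :: "nat \<Rightarrow> spoly"
    by simp
  show "poisson_lim (pgen zc) (pgen wc) N =
    (\<Sum>r<length z. \<Sum>q<length w. if z ! r = w ! q
       then pgen (circ (take r z @ [z ! r] @ drop (Suc q) w @ take q w @ drop (Suc r) z))
          - pgen (circ (take r z @ drop (Suc q) w @ take q w @ [z ! r] @ drop (Suc r) z))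
       else 0) N"
    unfolding poisson_lim_def z(1) w(1) poisson_pword[OF z(2) w(2)]
      sum_pointwise if_pointwise minus_apply pgen_circ ..
qed

end
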